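(* Let $k \geq 1$ be an integer and let $G$ be a $k$-connected finite simple undirected graph on $n \geq 2(k^2+k)$ vertices. If $|E(G)| > \binom{n-k}{2} + k^2$, then $G$ is hamiltonian. Moreover, the extremal graphs are unique: up to isomorphism there is exactly one $k$-connected nonhamiltonian graph on $n$ vertices with exactly $\binom{n-k}{2} + k^2$ edges, namely the graph consisting of a clique on $n-k$ vertices together with $k$ further pairwise nonadjacent vertices, each of which is adjacent to the same fixed set of $k$ vertices of the clique and to no other vertices.
   Context: A graph is hamiltonian if it contains a cycle through all of its vertices. A graph is $k$-connected if it has more than $k$ vertices and remains connected after deleting any set of fewer than $k$ vertices.
   Formalization: The uniqueness of the extremal graph is claimed for all pairs except k = 1, n = 5, where it fails: the join of an edge with three isolated vertices is a second connected nonhamiltonian graph with 5 vertices and 7 edges. *)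

theory Defs
  imports
    Complex_Main
    "Graph_Theory.Digraph_Component"
    "Graph_Theory.Digraph_Isomorphism"
    "Graph_Theory.Pair_Digraph"
begin

text \<open>
  Finite simple undirected graphs are rendered by \<open>pair_graph\<close>: finite, loop-free, symmetric
  digraphs without parallel arcs. Each undirected edge is thus a pair of opposite arcs, so edges
  have to be counted as two-element vertex sets and not as arcs.
\<close>

definition edges :: "'a pair_pre_digraph \<Rightarrow> 'a set set" where
  "edges G = {{u, v} | u v. (u, v) \<in> parcs G}"

definition k_connected :: "nat \<Rightarrow> 'a pair_pre_digraph \<Rightarrow> bool" where
  "k_connected k G \<longleftrightarrow>
     k < card (pverts G) \<and>
     (\<forall>S \<subseteq> pverts G. card S < k \<longrightarrow>
        Digraph_Component.connected (with_proj G \<restriction> (pverts G - S)))"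

text \<open>
  The bound on the length rules out the closed walk \<open>u, v, u\<close>, which \<open>cycle\<close> admits in a
  symmetric digraph. The vertices of a closed walk are the tails of its arcs.
\<close>

definition hamiltonian :: "'a pair_pre_digraph \<Rightarrow> bool" where
  "hamiltonian G \<longleftrightarrow>
     (\<exists>p. pre_digraph.cycle (with_proj G) p \<and> 3 \<le> length p \<and> fst ` set p = pverts G)"

text \<open>
  Meant for \<open>2 * k \<le> n\<close>: the clique is \<open>{..<n - k}\<close>, the pairwise nonadjacent vertices are
  \<open>{n - k..<n}\<close>, and their common neighbourhood is \<open>{..<k}\<close>.
\<close>

definition extremal_graph :: "nat \<Rightarrow> nat \<Rightarrow> nat pair_pre_digraph" where
  "extremal_graph n k =
     \<lparr> pverts = {..<n},
       parcs = {(u, v). u < n - k \<and> v < n - k \<and> u \<noteq> v}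
             \<union> {..<k} \<times> {n - k..<n}
             \<union> {n - k..<n} \<times> {..<k} \<rparr>"

text \<open>
  The extremal graph is not unique for \<open>k = 1\<close>, \<open>n = 5\<close>. There the bound is
  \<open>(4 choose 2) + 1 = 7\<close>, which is also the number of edges of the join of an edge with three
  isolated vertices. This join is \<open>extremal_graph 5 2\<close>.
\<close>

lemma two_extremal_graphs_5:
  shows "pair_graph (extremal_graph 5 2)"
    and "card (pverts (extremal_graph 5 2)) = 5"
    and "k_connected 1 (extremal_graph 5 2)"
    and "card (edges (extremal_graph 5 2)) = ((5 - 1) choose 2) + 1\<^sup>2"
    and "\<not> hamiltonian (extremal_graph 5 2)"
    and "\<not> digraph_iso (with_proj (extremal_graph 5 2)) (with_proj (extremal_graph 5 1))"
proof -
  let ?G = "extremal_graph 5 2"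
  let ?H = "extremal_graph 5 1"
  have V: "pverts ?G = {0, 1, 2, 3, 4}"
    by (auto simp: extremal_graph_def)
  have A: "parcs ?G = {(0,1),(1,0),(0,2),(2,0),(1,2),(2,1),(0,3),(3,0),(1,3),(3,1),
                       (0,4),(4,0),(1,4),(4,1)}"
  proof -
    have "{(u, v). u < 3 \<and> v < 3 \<and> u \<noteq> v} = {(0,1),(1,0),(0,2),(2,0),(1,2),(2,1 :: nat)}"
      by (auto simp: less_Suc_eq numeral_3_eq_3)
    moreover have "{3..<5} = {3, 4 :: nat}" "{..<2} = {0, 1 :: nat}"
      by auto
    ultimately show ?thesis
      by (simp add: extremal_graph_def insert_commute)
  qed
  have AH: "(u, 4) \<in> parcs ?H \<longleftrightarrow> u = 0" for u
    by (auto simp: extremal_graph_def)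
  show pg: "pair_graph ?G"
  proof unfold_locales
    show "finite (pverts ?G)" "finite (parcs ?G)"
      by (simp_all add: A V)
    show "symmetric (with_proj ?G)"
      by (simp add: symmetric_def sym_def extremal_graph_def)
  qed (auto simp: extremal_graph_def)
  show "card (pverts ?G) = 5"
    by (simp add: V)
  show "card (edges ?G) = ((5 - 1) choose 2) + 1\<^sup>2"
  proof -
    have "edges ?G = (\<lambda>(u, v). {u, v}) ` parcs ?G"
      by (auto simp: edges_def)
    then show ?thesis
      by (simp add: A doubleton_eq_iff choose_two card_insert_if)
  qed
  show "k_connected 1 ?G"
  proof -
    let ?M = "mk_symmetric (with_proj ?G \<restriction> pverts ?G)"
    have M: "pverts ?M = pverts ?G" "parcs ?M = parcs ?G"
      by (auto simp: mk_symmetric_def extremal_graph_def)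
    interpret M: pair_wf_digraph ?M
      by unfold_locales (unfold M, auto simp: extremal_graph_def)
    have adj: "u \<rightarrow>\<^sup>*\<^bsub>with_proj ?M\<^esub> v" if "(u, v) \<in> parcs ?G" for u v
      using that by (intro M.reachable_adjI) (simp add: M)
    have to0: "u \<rightarrow>\<^sup>*\<^bsub>with_proj ?M\<^esub> 0" and from0: "0 \<rightarrow>\<^sup>*\<^bsub>with_proj ?M\<^esub> u"
      if "u \<in> pverts ?G" for u
      using that adj[of u 0] adj[of 0 u] M.reachable_refl[of 0] by (auto simp: A V M)
    have "Digraph_Component.connected (with_proj ?G \<restriction> pverts ?G)"
      unfolding connected_def strongly_connected_def
      using M.reachable_trans[OF to0 from0] by (simp add: M) (simp add: V)
    moreover have "S = {}" if "S \<subseteq> pverts ?G" "card S < 1" for S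
      using that finite_subset[of S "pverts ?G"] by (auto simp: V)
    moreover have "1 < card (pverts ?G)"
      by (simp add: V)
    ultimately show ?thesis
      unfolding k_connected_def by (metis Diff_empty)
  qed
  show "\<not> hamiltonian ?G"
  proof
    assume "hamiltonian ?G"
    then obtain p u where p: "pre_digraph.awalk (with_proj ?G) u p u"
      and d: "distinct (tl (pawalk_verts u p))" and s: "fst ` set p = pverts ?G"
      unfolding hamiltonian_def pre_digraph.cycle_def by (auto simp: awalk_verts_with_proj_eq)
    have c: "pcas u p u" and sub: "set p \<subseteq> parcs ?G"
      using p by (auto simp: pre_digraph.awalk_def cas_with_proj_eq)
    have "pcas x p y \<Longrightarrow> tl (pawalk_verts x p) = map snd p" for x y
    proof (induct p arbitrary: x)
      case (Cons e es)
      then show ?case by (cases es) auto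
    qed simp
    with c d have inj: "inj_on snd (set p)"
      by (simp add: distinct_map)
    have "\<exists>y. (x, y) \<in> set p" if "x \<in> pverts ?G" for x
      using that unfolding s[symmetric] by force
    then obtain a b c where abc: "(2, a) \<in> set p" "(3, b) \<in> set p" "(4, c) \<in> set p"
      unfolding V by (meson insertI1 insertI2)
    have "a \<noteq> b" "a \<noteq> c" "b \<noteq> c"
      using inj_onD[OF inj _ abc(1) abc(2)] inj_onD[OF inj _ abc(1) abc(3)]
        inj_onD[OF inj _ abc(2) abc(3)] by auto
    moreover have "{a, b, c} \<subseteq> {0, 1}"
      using abc sub by (auto simp: A)
    ultimately show False
      by auto
  qed
  show "\<not> digraph_iso (with_proj ?G) (with_proj ?H)"
  proof
    assume "digraph_iso (with_proj ?G) (with_proj ?H)"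
    then obtain f where f: "pre_digraph.digraph_isomorphism (with_proj ?G) f"
      and H: "with_proj ?H = app_iso f (with_proj ?G)"
      by (auto simp: digraph_iso_def)
    have vH: "iso_verts f ` pverts ?G = pverts ?H"
      by (metis H verts_app_iso with_proj_simps(1))
    have aH: "iso_arcs f ` parcs ?G = parcs ?H"
      by (metis H arcs_app_iso with_proj_simps(2))
    have th: "iso_tail f = fst" "iso_head f = snd"
      by (metis H tail_app_iso with_proj_simps(4)) (metis H head_app_iso with_proj_simps(5))
    have inj: "inj_on (iso_verts f) (pverts ?G)"
      using f by (simp add: pre_digraph.digraph_isomorphism_def)
    have arc: "iso_arcs f (u, v) = (iso_verts f u, iso_verts f v)" if "(u, v) \<in> parcs ?G" for u v
      using f that th by (auto simp: pre_digraph.digraph_isomorphism_def intro!: prod_eqI)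
    have "4 \<in> pverts ?H"
      by (simp add: extremal_graph_def)
    then obtain w where w: "w \<in> pverts ?G" "iso_verts f w = 4"
      using vH by (metis imageE)
    obtain a b where ab: "(a, w) \<in> parcs ?G" "(b, w) \<in> parcs ?G" "a \<noteq> b"
      using w(1) unfolding A V by fastforce
    have "iso_verts f a = 0" "iso_verts f b = 0"
      using imageI[OF ab(1), of "iso_arcs f"] imageI[OF ab(2), of "iso_arcs f"]
      by (simp_all add: arc[OF ab(1)] arc[OF ab(2)] aH w(2) AH[simplified])
    then show False
      using inj_onD[OF inj, of a b] ab by (auto simp: extremal_graph_def)
  qed
qed

end

(*
  Enlarge a nonhamiltonian graph to an edge-maximal one and choose nonadjacent u, v with
  deg u + deg v maximal and i = deg u <= deg v. They are joined by a hamiltonian path, and the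
  predecessors on it of the neighbours of u form a set S of i vertices that are not adjacent to v;
  by the choice of u and v all of them have degree at most i. Hence 2i < n, and counting the edges
  that meet S gives at most (n - i choose 2) + i^2 edges, where i >= k by connectivity. For n as
  large as assumed this is largest at i = k, and only there except for k = 1, n = 5.
  In the case of equality V - S is a clique, S is independent and all its vertices have degree k;
  the maximality of deg u + deg v then forces them to have the same neighbours.
*)

theory Submission
  imports Defs
begin

section \<open>Hamiltonian cycles as vertex lists\<close>

text \<open>A vertex list over a bare relation replaces the arc walk, so that cycles can be cut,
  rotated and reversed by list operations and edges can be added without rebuilding a digraph. The
  start vertex is not repeated, hence the separate closing pair.\<close>

definition ham_cycle :: "'a set \<Rightarrow> 'a rel \<Rightarrow> 'a list \<Rightarrow> bool" where
  "ham_cycle V E xs \<longleftrightarrow>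
     3 \<le> length xs \<and> distinct xs \<and> set xs = V \<and>
     successively (\<lambda>u v. (u, v) \<in> E) xs \<and> (last xs, hd xs) \<in> E"

definition deg :: "'a rel \<Rightarrow> 'a \<Rightarrow> nat" where
  "deg E v = card (E `` {v})"

lemma pcas_fst_snd: "pcas u p v \<Longrightarrow> map fst p @ [v] = u # map snd p"
  by (induction p arbitrary: u) auto

lemma pawalk_verts_eq: "pcas u p v \<Longrightarrow> pawalk_verts u p = u # map snd p"
  by (induction p arbitrary: u) auto

lemma pcas_successively:
  "pcas u p v \<Longrightarrow> set p \<subseteq> E \<Longrightarrow> successively (\<lambda>x y. (x, y) \<in> E) (map fst p @ [v])"
proof (induction p arbitrary: u)
  case (Cons e p)
  then show ?case
    by (cases p) (auto simp: successively_Cons)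
qed simp

lemma successively_pcas:
  assumes "xs \<noteq> []" and "successively (\<lambda>x y. (x, y) \<in> E) (xs @ [v])"
  shows "pcas (hd xs) (zip xs (tl xs @ [v])) v \<and> set (zip xs (tl xs @ [v])) \<subseteq> E"
  using assms
proof (induction xs)
  case (Cons x xs)
  then show ?case
    by (cases xs) auto
qed simp

text \<open>The tails of the arcs of a cycle form such a list; conversely, zipping a list with its
  cyclic shift recovers the arcs.\<close>

lemma hamiltonian_iff_ham_cycle:
  "hamiltonian G \<longleftrightarrow> (\<exists>xs. ham_cycle (pverts G) (parcs G) xs)"
proof
  assume "hamiltonian G"
  then obtain p u where p: "u \<in> pverts G" "set p \<subseteq> parcs G" "pcas u p u"
    and d: "distinct (tl (pawalk_verts u p))" "3 \<le> length p" "fst ` set p = pverts G"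
    unfolding hamiltonian_def pre_digraph.cycle_def pre_digraph.awalk_def
    by (auto simp: awalk_verts_with_proj_eq cas_with_proj_eq)
  have ne: "p \<noteq> []"
    using d(2) by auto
  have eq: "map fst p @ [u] = u # map snd p"
    using p(3) by (rule pcas_fst_snd)
  then have u: "hd (map fst p) = u"
    using ne by (metis hd_append2 list.map_disc_iff list.sel(1))
  \<comment> \<open>\<open>cycle\<close> makes the heads distinct. Cancelling \<open>u\<close> shows
    that the tails are a permutation of the heads, so they are distinct as well.\<close>
  have "mset (map fst p) + {#u#} = mset (map snd p) + {#u#}"
    using arg_cong[OF eq, of mset] by simp
  then have "mset (map fst p) = mset (map snd p)"
    by simp
  then have "distinct (map fst p)"
    using d(1) pawalk_verts_eq[OF p(3)] by (metis list.sel(3) mset_eq_imp_distinct_iff)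
  moreover have "successively (\<lambda>u v. (u, v) \<in> parcs G) (map fst p @ [u])"
    using p by (intro pcas_successively)
  ultimately have "ham_cycle (pverts G) (parcs G) (map fst p)"
    using d ne u unfolding ham_cycle_def by (auto simp: successively_append_iff)
  then show "\<exists>xs. ham_cycle (pverts G) (parcs G) xs" ..
next
  assume "\<exists>xs. ham_cycle (pverts G) (parcs G) xs"
  then obtain xs where xs: "3 \<le> length xs" "distinct xs" "set xs = pverts G"
    "successively (\<lambda>u v. (u, v) \<in> parcs G) xs" "(last xs, hd xs) \<in> parcs G"
    unfolding ham_cycle_def by blast
  let ?p = "zip xs (tl xs @ [hd xs])"
  have ne: "xs \<noteq> []"
    using xs(1) by auto
  then have len: "length (tl xs @ [hd xs]) = length xs"
    by simp
  have p: "pcas (hd xs) ?p (hd xs)" "set ?p \<subseteq> parcs G"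
    using successively_pcas[OF ne, of "parcs G" "hd xs"] xs(4,5) ne
    by (auto simp: successively_append_iff)
  have "distinct (tl xs @ [hd xs])"
    using xs(2) ne by (cases xs) auto
  then have d: "distinct (tl (pawalk_verts (hd xs) ?p))"
    using pawalk_verts_eq[OF p(1)] len by simp
  have v: "hd xs \<in> pverts G" "?p \<noteq> []" "3 \<le> length ?p"
    using xs(1) ne by (simp_all flip: xs(3) add: zip_eq_Nil_iff)
  have "pre_digraph.awalk (with_proj G) (hd xs) ?p (hd xs)"
    unfolding pre_digraph.awalk_def cas_with_proj_eq with_proj_simps
    using v(1) p by (intro conjI)
  then have "pre_digraph.cycle (with_proj G) ?p"
    unfolding pre_digraph.cycle_def awalk_verts_with_proj_eq
    using d v(2) by (intro exI[of _ "hd xs"] conjI)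
  moreover have "fst ` set ?p = pverts G"
    using xs(3) len by (metis list.set_map map_fst_zip)
  ultimately show "hamiltonian G"
    unfolding hamiltonian_def using v(3) by (intro exI[of _ ?p] conjI)
qed

lemma ham_cycle_rotate: "ham_cycle V E (as @ bs) \<Longrightarrow> ham_cycle V E (bs @ as)"
  unfolding ham_cycle_def
  by (cases "as = []"; cases "bs = []") (auto simp: successively_append_iff)

section \<open>Simple graphs as symmetric relations, counted by arcs\<close>

text \<open>With \<open>V\<close> and \<open>E\<close> as separate parameters one vertex set can
  carry several graphs, as needed for supergraphs. Every edge is two arcs, so \<open>card E\<close>
  is twice the number of edges.\<close>

locale simple_graph =
  fixes V :: "'a set" and E :: "'a rel"
  assumes finite_V: "finite V"
    and E_subset: "E \<subseteq> V \<times> V"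
    and sym_E: "sym E"
    and irrefl_E: "irrefl E"
begin

lemma finite_E: "finite E"
  using finite_V E_subset by (meson finite_SigmaI finite_subset)

lemma E_commute: "(u, v) \<in> E \<longleftrightarrow> (v, u) \<in> E"
  using sym_E by (auto dest: symD)

lemma no_loop: "(u, u) \<notin> E"
  using irrefl_E by (auto simp: irrefl_def)

lemma simple_graph_add:
  assumes "u \<in> V" "v \<in> V" "u \<noteq> v"
  shows "simple_graph V (E \<union> {(u, v), (v, u)})"
  using assms finite_V E_subset sym_E irrefl_E
  by unfold_locales (auto simp: sym_def irrefl_def)

lemma successively_rev_E:
  "successively (\<lambda>u v. (u, v) \<in> E) (rev xs) \<longleftrightarrow> successively (\<lambda>u v. (u, v) \<in> E) xs"
proof -
  have "(\<lambda>u v. (v, u) \<in> E) = (\<lambda>u v. (u, v) \<in> E)"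
    by (intro ext) (rule E_commute)
  then show ?thesis
    by (simp only: successively_rev)
qed

text \<open>The cycle must use the new edge. Rotated so that this edge closes it, the list is a path
  in \<open>E\<close> with ends \<open>u\<close> and \<open>v\<close>, up to reversal.\<close>

lemma ham_path_of_ham_cycle_add:
  assumes nonham: "\<nexists>xs. ham_cycle V E xs"
    and ham: "ham_cycle V (E \<union> {(u, v), (v, u)}) xs"
  obtains ys where "distinct ys" "set ys = V" "hd ys = u" "last ys = v"
    "successively (\<lambda>u v. (u, v) \<in> E) ys"
proof -
  let ?F = "E \<union> {(u, v), (v, u)}"
  obtain zs where zs: "ham_cycle V ?F zs" "(last zs, hd zs) \<notin> E"
  proof (cases "successively (\<lambda>u v. (u, v) \<in> E) xs")
    case True
    then show ?thesis
      using that[OF ham] nonham ham by (auto simp: ham_cycle_def)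
  next
    case False
    then obtain i where i: "Suc i < length xs" "(xs ! i, xs ! Suc i) \<notin> E"
      unfolding successively_conv_nth by blast
    let ?zs = "drop (Suc i) xs @ take (Suc i) xs"
    have "ham_cycle V ?F ?zs"
      using ham by (intro ham_cycle_rotate[of _ _ "take (Suc i) xs" "drop (Suc i) xs"]) simp
    moreover have "hd ?zs = xs ! Suc i" "last ?zs = xs ! i"
      using i(1) by (simp_all add: hd_drop_conv_nth take_Suc_conv_app_nth)
    ultimately show ?thesis
      using that i(2) by metis
  qed
  have len: "3 \<le> length zs" and d: "distinct zs" and set: "set zs = V"
    and suc: "successively (\<lambda>u v. (u, v) \<in> ?F) zs" and lh: "(last zs, hd zs) \<in> ?F"
    using zs unfolding ham_cycle_def by auto
  have ne: "zs \<noteq> []"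
    using len by auto
  have ends: "{last zs, hd zs} = {u, v}"
    using lh zs(2) by auto
  have E: "successively (\<lambda>u v. (u, v) \<in> E) zs"
    unfolding successively_conv_nth
  proof (intro allI impI)
    fix i assume i: "Suc i < length zs"
    have "i < length zs" "length zs - 1 < length zs" "0 < length zs"
      using i by auto
    \<comment> \<open>By distinctness, equality would force \<open>i = 0\<close> and
      \<open>Suc i = length zs - 1\<close>, that is, a list of length 2. So the new edge occurs only
      as the closing one.\<close>
    then have "{zs ! i, zs ! Suc i} \<noteq> {zs ! (length zs - 1), zs ! 0}"
      unfolding doubleton_eq_iff using i len d by (simp add: nth_eq_iff_index_eq) linarith
    then have "{zs ! i, zs ! Suc i} \<noteq> {u, v}"
      using ends ne by (simp add: last_conv_nth hd_conv_nth)
    moreover have "(zs ! i, zs ! Suc i) \<in> ?F"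
      using suc i unfolding successively_conv_nth by blast
    ultimately show "(zs ! i, zs ! Suc i) \<in> E"
      by auto
  qed
  show ?thesis
  proof (cases "hd zs = u")
    case True
    then have "last zs = v"
      using ends by (auto simp: doubleton_eq_iff)
    then show ?thesis
      using that[of zs] d set E True by blast
  next
    case False
    then have "hd zs = v" "last zs = u"
      using ends by (auto simp: doubleton_eq_iff)
    then show ?thesis
      using that[of "rev zs"] d set E[THEN successively_rev_E[THEN iffD2]] ne
      by (simp add: hd_rev last_rev del: successively_rev)
  qed
qed

text \<open>The arcs that meet \<open>S\<close> are those leaving \<open>S\<close> and the reversals
  of those going from \<open>S\<close> to \<open>V - S\<close>. Twice the degree sum therefore
  counts the arcs inside \<open>S\<close> once too often; adding them on the left avoids
  subtraction.\<close>

lemma card_E_split: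
  assumes "S \<subseteq> V"
  shows "card E + card (E \<inter> S \<times> S) = card (E \<inter> (V - S) \<times> (V - S)) + 2 * (\<Sum>s\<in>S. deg E s)"
proof -
  let ?R = "V - S"
  have fS: "finite S"
    using assms finite_V finite_subset by blast
  have f: "finite (E \<inter> X)" for X
    using finite_E by simp
  have "E = (E \<inter> ?R \<times> ?R) \<union> (E \<inter> S \<times> V) \<union> (E \<inter> ?R \<times> S)"
    using E_subset by auto
  then have "card E = card ((E \<inter> ?R \<times> ?R) \<union> (E \<inter> S \<times> V) \<union> (E \<inter> ?R \<times> S))"
    by simp
  also have "\<dots> = card (E \<inter> ?R \<times> ?R) + card (E \<inter> S \<times> V) + card (E \<inter> ?R \<times> S)"
    using f by (subst card_Un_disjoint; auto)+
  finally have 1: "card E = card (E \<inter> ?R \<times> ?R) + card (E \<inter> S \<times> V) + card (E \<inter> ?R \<times> S)" .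
  have "E \<inter> ?R \<times> S = (E \<inter> S \<times> ?R)\<inverse>"
    using E_commute by auto
  then have 2: "card (E \<inter> ?R \<times> S) = card (E \<inter> S \<times> ?R)"
    by simp
  have "E \<inter> S \<times> V = (E \<inter> S \<times> S) \<union> (E \<inter> S \<times> ?R)"
    using assms by auto
  then have 3: "card (E \<inter> S \<times> V) = card (E \<inter> S \<times> S) + card (E \<inter> S \<times> ?R)"
    using f by (simp add: card_Un_disjoint disjoint_iff)
  have "E \<inter> S \<times> V = Sigma S (\<lambda>s. E `` {s})"
    using E_subset by auto
  then have 4: "card (E \<inter> S \<times> V) = (\<Sum>s\<in>S. deg E s)"
    using fS finite_E by (simp add: deg_def card_SigmaI finite_Image)
  show ?thesis
    using 1 2 3 4 by simp
qed

end

section \<open>Comparison of the arc bounds for \<open>i\<close> and \<open>k\<close>\<close>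

text \<open>The difference of the two bounds factors as \<open>(i - k) * D\<close> with
  \<open>D = 2 * n - 1 - 3 * i - 3 * k\<close>, so only the sign of \<open>D\<close> for
  \<open>i > k\<close> matters.\<close>

lemma arc_bound_mono:
  fixes i k n :: nat
  assumes "1 \<le> k" "2 * (k\<^sup>2 + k) \<le> n" "k \<le> i" "2 * i < n"
  shows "(n - i) * (n - i - 1) + 2 * i\<^sup>2 \<le> (n - k) * (n - k - 1) + 2 * k\<^sup>2"
    and "(n - i) * (n - i - 1) + 2 * i\<^sup>2 = (n - k) * (n - k - 1) + 2 * k\<^sup>2 \<Longrightarrow> (k, n) \<noteq> (1, 5) \<Longrightarrow> i = k"
proof -
  define D where "D = 2 * int n - 1 - 3 * int i - 3 * int k"
  have eq: "int ((n - k) * (n - k - 1) + 2 * k\<^sup>2) - int ((n - i) * (n - i - 1) + 2 * i\<^sup>2)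
      = (int i - int k) * D"
  proof -
    have "int (n - k) = int n - int k" "int (n - k - 1) = int n - int k - 1"
      "int (n - i) = int n - int i" "int (n - i - 1) = int n - int i - 1"
      using assms(3,4) by simp_all
    then show ?thesis
      unfolding of_nat_add of_nat_mult by (simp add: D_def power2_eq_square algebra_simps)
  qed
  have D: "0 \<le> D \<and> ((k, n) \<noteq> (1, 5) \<longrightarrow> 0 < D)" if "k < i"
  \<comment> \<open>For \<open>k = 1\<close>, \<open>n \<ge> 2 * i + 1\<close> gives
    \<open>D \<ge> i - 2\<close>, and \<open>D\<close> vanishes only at \<open>i = 2\<close>,
    \<open>n = 5\<close>. For \<open>k \<ge> 2\<close>, \<open>6 * k \<le> n\<close> and
    \<open>2 * i < n\<close> make \<open>D\<close> positive.\<close>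
  proof (cases "k = 1")
    case True
    then show ?thesis
      using assms that by (auto simp: D_def)
  next
    case False
    then have "2 * k \<le> k\<^sup>2"
      using assms(1) by (simp add: power2_eq_square)
    moreover have "2 * k\<^sup>2 + 2 * k \<le> n"
      using assms(2) by (simp add: algebra_simps)
    ultimately have "6 * k \<le> n"
      by linarith
    then show ?thesis
      using assms(4) unfolding D_def by linarith
  qed
  have "0 \<le> (int i - int k) * D"
    using D assms(3) by (cases "k = i") auto
  then show "(n - i) * (n - i - 1) + 2 * i\<^sup>2 \<le> (n - k) * (n - k - 1) + 2 * k\<^sup>2"
    using eq by linarith
  show "i = k" if "(n - i) * (n - i - 1) + 2 * i\<^sup>2 = (n - k) * (n - k - 1) + 2 * k\<^sup>2" "(k, n) \<noteq> (1, 5)"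
  proof (rule ccontr)
    assume "i \<noteq> k"
    then have "0 < (int i - int k) * D"
      using D assms(3) that(2) by simp
    then show False
      using eq that(1) by simp
  qed
qed

section \<open>Edge-maximal nonhamiltonian graphs\<close>

context simple_graph
begin

lemma ham_cycle_complete:
  assumes "3 \<le> card V" "\<And>u v. u \<in> V \<Longrightarrow> v \<in> V \<Longrightarrow> u \<noteq> v \<Longrightarrow> (u, v) \<in> E"
  shows "\<exists>xs. ham_cycle V E xs"
proof -
  obtain xs where xs: "set xs = V" "distinct xs"
    using finite_distinct_list[OF finite_V] by blast
  then have len: "3 \<le> length xs"
    using assms(1) distinct_card by metis
  have ne: "xs \<noteq> []"
    using len by auto
  have *: "(xs ! i, xs ! j) \<in> E" if "i < length xs" "j < length xs" "i \<noteq> j" for i j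
    using that xs by (intro assms(2)) (auto simp: nth_eq_iff_index_eq)
  have "ham_cycle V E xs"
    using xs len ne * unfolding ham_cycle_def
    by (auto simp: successively_conv_nth last_conv_nth hd_conv_nth)
  then show ?thesis ..
qed

text \<open>
  If \<open>x\<^sub>0, \<dots>, x\<^sub>m\<close> is a hamiltonian path, \<open>x\<^sub>0\<close> is adjacent to \<open>x\<^bsub>j+1\<^esub>\<close> and
  \<open>x\<^sub>j\<close> to \<open>x\<^sub>m\<close>, then reversing the segment after \<open>x\<^sub>j\<close> closes the path to a cycle.
\<close>

lemma crossing_ham_cycle:
  assumes xs: "distinct xs" "set xs = V" "successively (\<lambda>u v. (u, v) \<in> E) xs" "3 \<le> length xs"
    and j: "Suc j < length xs" "(hd xs, xs ! Suc j) \<in> E" "(xs ! j, last xs) \<in> E"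
  shows "ham_cycle V E (take (Suc j) xs @ rev (drop (Suc j) xs))"
proof -
  let ?a = "take (Suc j) xs" and ?b = "drop (Suc j) xs"
  have ne: "?a \<noteq> []" "?b \<noteq> []"
    using j(1) by auto
  have "successively (\<lambda>u v. (u, v) \<in> E) (?a @ ?b)"
    using xs(3) by simp
  then have suc: "successively (\<lambda>u v. (u, v) \<in> E) ?a" "successively (\<lambda>u v. (u, v) \<in> E) ?b"
    unfolding successively_append_iff by auto
  have "hd ?a = hd xs"
    by simp
  moreover have "last ?a = xs ! j" "hd ?b = xs ! Suc j" "last ?b = last xs"
    using j(1) by (simp_all add: hd_drop_conv_nth take_Suc_conv_app_nth)
  ultimately have ends: "hd ?a = hd xs" "last ?a = xs ! j" "hd ?b = xs ! Suc j" "last ?b = last xs" .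
  have 1: "distinct (?a @ rev ?b)"
    using xs(1) by (metis append_take_drop_id distinct_append distinct_rev set_rev)
  have 2: "set (?a @ rev ?b) = V"
    using xs(2) by (metis append_take_drop_id set_append set_rev)
  have "successively (\<lambda>u v. (u, v) \<in> E) (rev ?b)"
    using suc(2) by (simp only: successively_rev_E)
  then have 3: "successively (\<lambda>u v. (u, v) \<in> E) (?a @ rev ?b)"
    using suc(1) j(3) ends by (simp add: successively_append_iff hd_rev del: successively_rev)
  have 4: "(last (?a @ rev ?b), hd (?a @ rev ?b)) \<in> E"
    using ne ends j(2) by (simp add: last_rev hd_append2 E_commute del: take_eq_Nil drop_eq_Nil)
  have 5: "3 \<le> length (?a @ rev ?b)"
    using xs(4) j(1) by simp
  show ?thesis
    unfolding ham_cycle_def using 1 2 3 4 5 by (intro conjI)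
qed

text \<open>\<open>S\<close> collects the predecessors on the path of the neighbours of
  \<open>hd xs\<close>, with \<open>J\<close> their positions. If one of them were adjacent to
  \<open>last xs\<close>, \<open>crossing_ham_cycle\<close> would close the path to a cycle.\<close>

lemma low_degree_set_of_path:
  assumes nonham: "\<nexists>xs. ham_cycle V E xs" and "3 \<le> card V"
    and xs: "distinct xs" "set xs = V" "successively (\<lambda>u v. (u, v) \<in> E) xs"
  obtains S where "S \<subseteq> V" "card S = deg E (hd xs)" "last xs \<notin> S"
    "\<And>s. s \<in> S \<Longrightarrow> (s, last xs) \<notin> E"
proof -
  let ?u = "hd xs" and ?v = "last xs"
  define J where "J = {j. Suc j < length xs \<and> (?u, xs ! Suc j) \<in> E}"
  let ?S = "(\<lambda>j. xs ! j) ` J"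
  have len: "3 \<le> length xs"
    using xs(1,2) assms(2) distinct_card by metis
  then have ne: "xs \<noteq> []"
    by auto
  have inj: "inj_on (\<lambda>j. xs ! j) J" "inj_on (\<lambda>j. xs ! Suc j) J"
    using xs(1) by (auto simp: inj_on_def J_def nth_eq_iff_index_eq)
  have "E `` {?u} = (\<lambda>j. xs ! Suc j) ` J"
  proof (intro equalityI subsetI)
    fix w assume "w \<in> E `` {?u}"
    then have w: "(?u, w) \<in> E"
      by simp
    then have "w \<in> set xs"
      using E_subset xs(2) by auto
    then obtain i where i: "i < length xs" "xs ! i = w"
      by (auto simp: in_set_conv_nth)
    \<comment> \<open>A neighbour of \<open>hd xs\<close> is not \<open>hd xs\<close> itself, so it
      has a predecessor; hence no neighbour is lost in counting \<open>J\<close>.\<close>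
    moreover have "i \<noteq> 0"
      using i(2) w no_loop ne by (metis hd_conv_nth)
    ultimately have "i - 1 \<in> J" "xs ! Suc (i - 1) = w"
      using w by (auto simp: J_def)
    then show "w \<in> (\<lambda>j. xs ! Suc j) ` J"
      by blast
  qed (auto simp: J_def)
  then have "card ?S = deg E ?u"
    using inj by (simp add: deg_def card_image)
  moreover have "?S \<subseteq> V"
    using xs(2) by (auto simp: J_def)
  moreover have "?v \<notin> ?S"
    using xs(1) ne by (auto simp: J_def last_conv_nth nth_eq_iff_index_eq)
  moreover have "(s, ?v) \<notin> E" if "s \<in> ?S" for s
  proof
    assume "(s, ?v) \<in> E"
    moreover obtain j where "Suc j < length xs" "(?u, xs ! Suc j) \<in> E" "s = xs ! j"
      using \<open>s \<in> ?S\<close> by (auto simp: J_def)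
    ultimately show False
      using crossing_ham_cycle[OF xs len] nonham by blast
  qed
  ultimately show ?thesis
    using that by blast
qed

text \<open>Edge-maximality joins every nonadjacent pair by a hamiltonian path. The pair with the
  largest degree sum is chosen because every vertex of \<open>S\<close> can take the place of
  \<open>u\<close> in it, which bounds the degrees in \<open>S\<close>.\<close>

lemma edge_maximal_low_degree_set:
  assumes nonham: "\<nexists>xs. ham_cycle V E xs" and n: "3 \<le> card V"
    and maximal: "\<And>u v. u \<in> V \<Longrightarrow> v \<in> V \<Longrightarrow> u \<noteq> v \<Longrightarrow> (u, v) \<notin> E \<Longrightarrow>
      \<exists>xs. ham_cycle V (E \<union> {(u, v), (v, u)}) xs"
  obtains u v S where "u \<in> V" "v \<in> V - S" "S \<subseteq> V" "card S = deg E u" "2 * deg E u < card V"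
    "\<And>s. s \<in> S \<Longrightarrow> (s, v) \<notin> E" "\<And>s. s \<in> S \<Longrightarrow> deg E s \<le> deg E u"
    "\<And>x y. x \<in> V \<Longrightarrow> y \<in> V \<Longrightarrow> x \<noteq> y \<Longrightarrow> (x, y) \<notin> E \<Longrightarrow> deg E x + deg E y \<le> deg E u + deg E v"
proof -
  define P where "P = {(x, y). x \<in> V \<and> y \<in> V \<and> x \<noteq> y \<and> (x, y) \<notin> E}"
  let ?f = "\<lambda>(x, y). deg E x + deg E y"
  have "P \<subseteq> V \<times> V"
    by (auto simp: P_def)
  then have fin: "finite P"
    using finite_V by (meson finite_SigmaI finite_subset)
  have "P \<noteq> {}"
    using ham_cycle_complete[OF n] nonham by (auto simp: P_def)
  then have "Max (?f ` P) \<in> ?f ` P"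
    using fin by simp
  then obtain a b where ab: "(a, b) \<in> P" "?f (a, b) = Max (?f ` P)"
    by auto
  \<comment> \<open>The pair is ordered so that \<open>u\<close> has the smaller degree; this is
    what turns the bound on \<open>deg E v\<close> below into
    \<open>2 * deg E u < card V\<close>.\<close>
  define u v where "u = (if deg E a \<le> deg E b then a else b)"
    and "v = (if deg E a \<le> deg E b then b else a)"
  have uv: "u \<in> V" "v \<in> V" "u \<noteq> v" "(u, v) \<notin> E" "deg E u \<le> deg E v"
    "deg E u + deg E v = Max (?f ` P)"
    using ab E_commute by (auto simp: u_def v_def P_def)
  have max: "deg E x + deg E y \<le> deg E u + deg E v"
    if "x \<in> V" "y \<in> V" "x \<noteq> y" "(x, y) \<notin> E" for x y
  proof -
    have "?f (x, y) \<le> Max (?f ` P)"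
      using fin that by (intro Max_ge) (auto simp: P_def)
    then show ?thesis
      using uv(6) by simp
  qed
  obtain xs where "ham_cycle V (E \<union> {(u, v), (v, u)}) xs"
    using maximal uv by blast
  then obtain ys where ys: "distinct ys" "set ys = V" "hd ys = u" "last ys = v"
    "successively (\<lambda>u v. (u, v) \<in> E) ys"
    using ham_path_of_ham_cycle_add[OF nonham] by blast
  obtain S where S: "S \<subseteq> V" "card S = deg E u" "v \<notin> S" "\<And>s. s \<in> S \<Longrightarrow> (s, v) \<notin> E"
    using low_degree_set_of_path[OF nonham n ys(1,2,5)] unfolding ys by blast
  \<comment> \<open>Neither \<open>v\<close> nor any of the \<open>deg E u\<close> vertices of
    \<open>S\<close> is a neighbour of \<open>v\<close>.\<close>
  have "E `` {v} \<subseteq> V - S - {v}"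
    using S(4) E_subset E_commute no_loop by blast
  then have "deg E v \<le> card (V - S - {v})"
    unfolding deg_def using finite_V by (intro card_mono) auto
  also have "\<dots> = card V - card S - 1"
    using S(1,3) uv(2) finite_subset[OF S(1) finite_V] by (simp add: card_Diff_subset)
  finally have "2 * deg E u < card V"
    using uv(5) S(2) n by linarith
  moreover have "deg E s \<le> deg E u" if "s \<in> S" for s
  proof -
    \<comment> \<open>\<open>s\<close> and \<open>v\<close> are themselves a nonadjacent pair and
      compete with \<open>u\<close> and \<open>v\<close>.\<close>
    have "deg E s + deg E v \<le> deg E u + deg E v"
      using that S uv(2) by (intro max) auto
    then show ?thesis
      by simp
  qed
  ultimately show ?thesis
    using that[of u v S] uv S max by blast
qed

lemma card_arcs_le:
  assumes "finite R"
  shows "card (E \<inter> R \<times> R) \<le> card R * (card R - 1)"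
    and "card (E \<inter> R \<times> R) = card R * (card R - 1) \<Longrightarrow> x \<in> R \<Longrightarrow> y \<in> R \<Longrightarrow> x \<noteq> y \<Longrightarrow> (x, y) \<in> E"
proof -
  let ?C = "Sigma R (\<lambda>x. R - {x})"
  have C: "card ?C = card R * (card R - 1)"
    using assms by (simp add: card_SigmaI)
  have sub: "E \<inter> R \<times> R \<subseteq> ?C" and fin: "finite ?C"
    using no_loop assms by auto
  show "card (E \<inter> R \<times> R) \<le> card R * (card R - 1)"
    using card_mono[OF fin sub] C by simp
  show "(x, y) \<in> E" if "card (E \<inter> R \<times> R) = card R * (card R - 1)" "x \<in> R" "y \<in> R" "x \<noteq> y"
    using card_subset_eq[OF fin sub] C that by auto
qed

text \<open>With \<open>i = deg E u\<close>, at most all arcs inside \<open>V - S\<close> are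
  present, and the degree sum over \<open>S\<close> is at most \<open>i\<^sup>2\<close>.
  \<open>arc_bound_mono\<close> then replaces \<open>i\<close> by \<open>k\<close>. For equality all
  these estimates are tight, and the choice of \<open>u\<close> and \<open>v\<close> is used once
  more.\<close>

lemma edge_maximal_bound:
  assumes nonham: "\<nexists>xs. ham_cycle V E xs"
    and maximal: "\<And>u v. u \<in> V \<Longrightarrow> v \<in> V \<Longrightarrow> u \<noteq> v \<Longrightarrow> (u, v) \<notin> E \<Longrightarrow>
      \<exists>xs. ham_cycle V (E \<union> {(u, v), (v, u)}) xs"
    and k: "1 \<le> k" "2 * (k\<^sup>2 + k) \<le> card V" and min_deg: "\<And>x. x \<in> V \<Longrightarrow> k \<le> deg E x"
  shows "card E \<le> (card V - k) * (card V - k - 1) + 2 * k\<^sup>2"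
    and "card E = (card V - k) * (card V - k - 1) + 2 * k\<^sup>2 \<Longrightarrow> (k, card V) \<noteq> (1, 5) \<Longrightarrow>
      \<exists>S K. S \<subseteq> V \<and> K \<subseteq> V - S \<and> card S = k \<and> card K = k \<and>
        E = {(x, y). x \<in> V - S \<and> y \<in> V - S \<and> x \<noteq> y} \<union> K \<times> S \<union> S \<times> K"
proof -
  have "1 * 1 \<le> k * k"
    using k(1) by (intro mult_le_mono)
  moreover have "2 * (k * k) + 2 * k \<le> card V"
    using k(2) by (simp add: power2_eq_square algebra_simps)
  ultimately have n: "3 \<le> card V"
    using k(1) by linarith
  obtain u v S where u: "u \<in> V" and v: "v \<in> V - S" and S: "S \<subseteq> V" "card S = deg E u"
    and small: "2 * deg E u < card V"
    and nonadj: "\<And>s. s \<in> S \<Longrightarrow> (s, v) \<notin> E" and low: "\<And>s. s \<in> S \<Longrightarrow> deg E s \<le> deg E u"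
    and max: "\<And>x y. x \<in> V \<Longrightarrow> y \<in> V \<Longrightarrow> x \<noteq> y \<Longrightarrow> (x, y) \<notin> E \<Longrightarrow>
      deg E x + deg E y \<le> deg E u + deg E v"
    using edge_maximal_low_degree_set[OF nonham n maximal] by blast
  define i where "i = deg E u"
  let ?R = "V - S"
  have finS: "finite S" and finR: "finite ?R"
    using S(1) finite_V finite_subset by auto
  have R: "card ?R = card V - i"
    using S finS by (simp add: card_Diff_subset i_def)
  have i: "k \<le> i" "2 * i < card V"
    using min_deg[OF u] small by (auto simp: i_def)
  have clique: "card (E \<inter> ?R \<times> ?R) \<le> (card V - i) * (card V - i - 1)"
    using card_arcs_le(1)[OF finR] R by simp
  have sum: "(\<Sum>s\<in>S. deg E s) \<le> i\<^sup>2"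
    using sum_bounded_above[of S "deg E" i] low S(2) by (simp add: i_def power2_eq_square)
  have split: "card E + card (E \<inter> S \<times> S) = card (E \<inter> ?R \<times> ?R) + 2 * (\<Sum>s\<in>S. deg E s)"
    using card_E_split[OF S(1)] .
  have bound: "card E \<le> (card V - i) * (card V - i - 1) + 2 * i\<^sup>2"
    using split clique sum by linarith
  note mono = arc_bound_mono[OF k i]
  show "card E \<le> (card V - k) * (card V - k - 1) + 2 * k\<^sup>2"
    using bound mono(1) by linarith
  assume eq: "card E = (card V - k) * (card V - k - 1) + 2 * k\<^sup>2" and ne: "(k, card V) \<noteq> (1, 5)"
  have ik: "i = k"
    using bound mono(1) eq ne by (intro mono(2)) auto
  \<comment> \<open>Equality leaves no slack in \<open>split\<close>, \<open>clique\<close> and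
    \<open>sum\<close>: no arc lies inside \<open>S\<close>, and every possible arc lies inside
    \<open>?R\<close>.\<close>
  have "card (E \<inter> S \<times> S) = 0" and clique_eq: "card (E \<inter> ?R \<times> ?R) = card ?R * (card ?R - 1)"
    using split clique sum eq unfolding ik R by linarith+
  then have indep: "E \<inter> S \<times> S = {}"
    using finite_E by simp
  have degS: "deg E s = k" if "s \<in> S" for s
    using low[OF that] min_deg[of s] that S(1) ik by (auto simp: i_def)
  have adjR: "(x, y) \<in> E" if "x \<in> ?R" "y \<in> ?R" "x \<noteq> y" for x y
    using card_arcs_le(2)[OF finR clique_eq] that by blast
  have "E `` {v} = ?R - {v}"
    using adjR[OF v] nonadj E_subset E_commute no_loop by blast
  then have degv: "deg E v = card ?R - 1"
    using v finR by (simp add: deg_def)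
  \<comment> \<open>If \<open>w\<close> had a neighbour \<open>t\<close> in \<open>S\<close>, its
    degree would be at least \<open>card ?R\<close>, one more than that of \<open>v\<close>. As
    \<open>s\<close> has the same degree \<open>k\<close> as \<open>u\<close>, the nonadjacent pair
    \<open>s\<close>, \<open>w\<close> would beat \<open>u\<close>, \<open>v\<close>.\<close>
  have common: "(t, w) \<notin> E" if "s \<in> S" "w \<in> ?R" "(s, w) \<notin> E" "t \<in> S" for s t w
  proof
    assume "(t, w) \<in> E"
    then have "insert t (?R - {w}) \<subseteq> E `` {w}"
      using adjR[OF that(2)] E_commute by blast
    then have "card (insert t (?R - {w})) \<le> deg E w"
      unfolding deg_def using finite_E by (intro card_mono finite_Image)
    then have "card ?R \<le> deg E w"
      using that(2,4) finR by (simp add: card.insert_remove card_gt_0_iff)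
    moreover have "deg E s + deg E w \<le> deg E u + deg E v"
      using that S(1) by (intro max) auto
    moreover have "0 < card ?R"
      using v finR by (auto simp: card_gt_0_iff)
    ultimately show False
      using degS[OF that(1)] degv ik by (simp add: i_def)
  qed
  have cS: "card S = k"
    using S(2) ik by (simp add: i_def)
  then obtain s where s: "s \<in> S"
    using k(1) by (metis card.empty equals0I not_one_le_zero)
  \<comment> \<open>By \<open>common\<close> the choice of \<open>s\<close> does not matter: all
    vertices of \<open>S\<close> have the neighbourhood \<open>K\<close>.\<close>
  define K where "K = E `` {s}"
  have K: "K \<subseteq> ?R" "card K = k"
    using indep s E_subset degS by (auto simp: K_def deg_def)
  have nbr: "(t, w) \<in> E \<longleftrightarrow> w \<in> K" if "t \<in> S" for t w
  proof (cases "w \<in> ?R")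
    case True
    then show ?thesis
      using common[OF s True _ that] common[OF that True _ s] by (auto simp: K_def)
  next
    case False
    then show ?thesis
      using that K(1) indep E_subset by auto
  qed
  have "E = {(x, y). x \<in> ?R \<and> y \<in> ?R \<and> x \<noteq> y} \<union> K \<times> S \<union> S \<times> K"
  proof (intro equalityI subrelI)
    fix x y assume xy: "(x, y) \<in> E"
    then show "(x, y) \<in> {(x, y). x \<in> ?R \<and> y \<in> ?R \<and> x \<noteq> y} \<union> K \<times> S \<union> S \<times> K"
      using nbr[of x y] nbr[of y x] E_commute[of x y] E_subset no_loop by auto
  next
    fix x y assume "(x, y) \<in> {(x, y). x \<in> ?R \<and> y \<in> ?R \<and> x \<noteq> y} \<union> K \<times> S \<union> S \<times> K"
    then show "(x, y) \<in> E"
      using nbr[of x y] nbr[of y x] E_commute[of x y] adjR by auto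
  qed
  then show "\<exists>S K. S \<subseteq> V \<and> K \<subseteq> V - S \<and> card S = k \<and> card K = k \<and>
        E = {(x, y). x \<in> V - S \<and> y \<in> V - S \<and> x \<noteq> y} \<union> K \<times> S \<union> S \<times> K"
    using S(1) K cS by blast
qed

text \<open>There are only finitely many relations on \<open>V\<close>, so some nonhamiltonian
  simple graph above \<open>E\<close> is maximal under inclusion.\<close>

lemma nonham_edge_maximal_supergraph:
  assumes "\<nexists>xs. ham_cycle V E xs"
  obtains F where "simple_graph V F" "E \<subseteq> F" "\<nexists>xs. ham_cycle V F xs"
    "\<And>u v. u \<in> V \<Longrightarrow> v \<in> V \<Longrightarrow> u \<noteq> v \<Longrightarrow> (u, v) \<notin> F \<Longrightarrow> \<exists>xs. ham_cycle V (F \<union> {(u, v), (v, u)}) xs"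
proof -
  define A where "A = {F. simple_graph V F \<and> (\<nexists>xs. ham_cycle V F xs)}"
  have "A \<subseteq> Pow (V \<times> V)"
    using simple_graph.E_subset by (force simp: A_def)
  then have "finite A"
    using finite_V by (meson finite_Pow_iff finite_SigmaI finite_subset)
  moreover have "E \<in> A"
    using assms simple_graph_axioms by (simp add: A_def)
  ultimately obtain F where F: "F \<in> A" "E \<subseteq> F" "\<And>H. H \<in> A \<Longrightarrow> F \<subseteq> H \<Longrightarrow> F = H"
    using finite_has_maximal2[of A E] by blast
  have "\<exists>xs. ham_cycle V (F \<union> {(u, v), (v, u)}) xs"
    if "u \<in> V" "v \<in> V" "u \<noteq> v" "(u, v) \<notin> F" for u v
  proof (rule ccontr)
    assume "\<nexists>xs. ham_cycle V (F \<union> {(u, v), (v, u)}) xs"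
    then have "F \<union> {(u, v), (v, u)} \<in> A"
      using F(1) simple_graph.simple_graph_add that by (force simp: A_def)
    then show False
      using F(3) that(4) by blast
  qed
  then show ?thesis
    using that[of F] F by (simp add: A_def)
qed

text \<open>An edge-maximal supergraph \<open>F\<close> inherits the lower bound on the degrees and
  has at least as many arcs. If \<open>E\<close> already attains the bound, then so does
  \<open>F\<close>, hence \<open>E = F\<close> and the structure of \<open>F\<close> is that of
  \<open>E\<close>.\<close>

lemma nonham_bound:
  assumes nonham: "\<nexists>xs. ham_cycle V E xs"
    and k: "1 \<le> k" "2 * (k\<^sup>2 + k) \<le> card V" and min_deg: "\<And>x. x \<in> V \<Longrightarrow> k \<le> deg E x"
  shows "card E \<le> (card V - k) * (card V - k - 1) + 2 * k\<^sup>2"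
    and "card E = (card V - k) * (card V - k - 1) + 2 * k\<^sup>2 \<Longrightarrow> (k, card V) \<noteq> (1, 5) \<Longrightarrow>
      \<exists>S K. S \<subseteq> V \<and> K \<subseteq> V - S \<and> card S = k \<and> card K = k \<and>
        E = {(x, y). x \<in> V - S \<and> y \<in> V - S \<and> x \<noteq> y} \<union> K \<times> S \<union> S \<times> K"
proof -
  obtain F where F: "simple_graph V F" "E \<subseteq> F" "\<nexists>xs. ham_cycle V F xs"
    and maximal: "\<And>u v. u \<in> V \<Longrightarrow> v \<in> V \<Longrightarrow> u \<noteq> v \<Longrightarrow> (u, v) \<notin> F \<Longrightarrow>
      \<exists>xs. ham_cycle V (F \<union> {(u, v), (v, u)}) xs"
    using nonham_edge_maximal_supergraph[OF nonham] by blast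
  interpret F: simple_graph V F
    by (rule F(1))
  have deg_F: "k \<le> deg F x" if "x \<in> V" for x
  proof -
    have "deg E x \<le> deg F x"
      unfolding deg_def using F(2) F.finite_E by (intro card_mono) auto
    then show ?thesis
      using min_deg[OF that] by simp
  qed
  note bound = F.edge_maximal_bound[OF F(3) maximal k deg_F]
  have le: "card E \<le> card F"
    using F(2) F.finite_E by (rule card_mono[rotated])
  then show "card E \<le> (card V - k) * (card V - k - 1) + 2 * k\<^sup>2"
    using bound(1) by simp
  assume eq: "card E = (card V - k) * (card V - k - 1) + 2 * k\<^sup>2" and ne: "(k, card V) \<noteq> (1, 5)"
  then have "card E = card F"
    using le bound(1) by simp
  then have "E = F"
    using F(2) F.finite_E card_subset_eq by blast
  then show "\<exists>S K. S \<subseteq> V \<and> K \<subseteq> V - S \<and> card S = k \<and> card K = k \<and>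
        E = {(x, y). x \<in> V - S \<and> y \<in> V - S \<and> x \<noteq> y} \<union> K \<times> S \<union> S \<times> K"
    using bound(2) eq ne by simp
qed

end

section \<open>Edge counts and minimum degree of pair graphs\<close>

lemma pair_graph_simple_graph:
  assumes "pair_graph G"
  shows "simple_graph (pverts G) (parcs G)"
proof -
  interpret pair_graph G
    by (rule assms)
  have "irrefl (parcs G)"
    using pair_no_loops by (fastforce simp: irrefl_def)
  then show ?thesis
    using pair_finite_verts in_arcsD1 in_arcsD2 pair_sym_arcs
    by unfold_locales (auto simp: symmetric_def)
qed

text \<open>Each fibre of the map forgetting orientation consists of two opposite arcs, which differ
  because there are no loops.\<close>

lemma (in simple_graph) card_arcs_eq_twice_edges:
  "card E = 2 * card {{u, v} | u v. (u, v) \<in> E}"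
proof -
  let ?f = "\<lambda>(u, v). {u, v}"
  have "card E = (\<Sum>a\<in>E. 1)"
    by simp
  also have "\<dots> = (\<Sum>e\<in>?f ` E. \<Sum>a | a \<in> E \<and> ?f a = e. 1)"
    using finite_E by (rule sum.image_gen)
  also have "\<dots> = (\<Sum>e\<in>?f ` E. 2)"
  proof (rule sum.cong)
    fix e assume "e \<in> ?f ` E"
    then obtain u v where uv: "(u, v) \<in> E" "e = {u, v}"
      by auto
    then have "{a \<in> E. ?f a = e} = {(u, v), (v, u)}"
      using E_commute by (auto simp: doubleton_eq_iff)
    moreover have "u \<noteq> v"
      using uv no_loop by auto
    ultimately show "(\<Sum>a | a \<in> E \<and> ?f a = e. 1) = (2 :: nat)"
      by simp
  qed simp
  also have "?f ` E = {{u, v} | u v. (u, v) \<in> E}"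
    by auto
  finally show ?thesis
    by simp
qed

lemma card_parcs_eq_twice_edges:
  "pair_graph G \<Longrightarrow> card (parcs G) = 2 * card (edges G)"
  unfolding edges_def by (rule simple_graph.card_arcs_eq_twice_edges[OF pair_graph_simple_graph])

lemma twice_choose_two: "2 * (m choose 2) = m * (m - 1)" for m :: nat
proof -
  have "even (m * (m - 1))"
    by (cases m) simp_all
  then show ?thesis
    by (simp add: choose_two)
qed

text \<open>Deleting the neighbours of \<open>x\<close> isolates it. If there were fewer than
  \<open>k\<close> of them, another vertex would remain, since the graph has more than
  \<open>k\<close> vertices, and the rest would be disconnected.\<close>

lemma k_connected_min_degree:
  assumes "pair_graph G" "k_connected k G" "x \<in> pverts G"
  shows "k \<le> deg (parcs G) x"
proof (rule ccontr)
  interpret simple_graph "pverts G" "parcs G"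
    using assms(1) by (rule pair_graph_simple_graph)
  let ?S = "parcs G `` {x}"
  let ?M = "mk_symmetric (with_proj G \<restriction> (pverts G - ?S))"
  assume "\<not> k \<le> deg (parcs G) x"
  then have less: "card ?S < k"
    by (simp add: deg_def)
  moreover have S: "?S \<subseteq> pverts G"
    using E_subset by auto
  ultimately have conn: "Digraph_Component.connected (with_proj G \<restriction> (pverts G - ?S))"
    using assms(2) by (auto simp: k_connected_def)
  have x: "x \<in> pverts G - ?S"
    using assms(3) no_loop by auto
  have "\<not> pverts G \<subseteq> insert x ?S"
  proof
    assume "pverts G \<subseteq> insert x ?S"
    then have "card (pverts G) \<le> card (insert x ?S)"
      using finite_E by (intro card_mono) (auto simp: finite_Image)
    also have "\<dots> \<le> Suc (card ?S)"
      by (rule card_insert_le_m1) auto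
    finally show False
      using less assms(2) by (simp add: k_connected_def)
  qed
  then obtain y where y: "y \<in> pverts G - ?S" "y \<noteq> x"
    by auto
  have "x \<rightarrow>\<^sup>*\<^bsub>with_proj ?M\<^esub> y"
    using conn x y unfolding connected_def strongly_connected_def by simp
  then have "y = x"
    unfolding reachable_def
  \<comment> \<open>No arc at \<open>x\<close> survives the deletion, so a walk from
    \<open>x\<close> never leaves \<open>x\<close>.\<close>
  proof (induction rule: rtrancl_on_induct)
    case (step y z)
    then show ?case
      using E_commute no_loop by (auto simp: parcs_mk_symmetric)
  qed simp
  then show False
    using y(2) by simp
qed

section \<open>The extremal graph: nonhamiltonian and \<open>k\<close>-connected\<close>

text \<open>Since the list does not end in \<open>I\<close>, each visit to \<open>I\<close> is
  followed by its own visit to \<open>K\<close>. A list that starts outside \<open>I\<close> also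
  meets \<open>K\<close> before its first visit to \<open>I\<close>, which gives the extra
  1.\<close>

lemma successively_count_le:
  assumes "xs \<noteq> []" "successively (\<lambda>x y. (x, y) \<in> E) xs" "last xs \<notin> I"
    and "\<And>x y. (x, y) \<in> E \<Longrightarrow> x \<in> I \<Longrightarrow> y \<in> K" "\<And>x y. (x, y) \<in> E \<Longrightarrow> y \<in> I \<Longrightarrow> x \<in> K"
    and "I \<inter> K = {}"
  shows "set xs \<inter> I = {} \<or>
    length (filter (\<lambda>x. x \<in> I) xs) + (if hd xs \<in> I then 0 else 1) \<le> length (filter (\<lambda>x. x \<in> K) xs)"
  using assms(1-3)
proof (induction xs)
  case (Cons x xs)
  show ?case
  proof (cases xs)
    case Nil
    then show ?thesis
      using Cons.prems by simp
  next
    case (Cons y ys)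
    then have xy: "(x, y) \<in> E"
      and IH: "set xs \<inter> I = {} \<or> length (filter (\<lambda>x. x \<in> I) xs) + (if y \<in> I then 0 else 1)
        \<le> length (filter (\<lambda>x. x \<in> K) xs)"
      using Cons.IH Cons.prems by auto
    show ?thesis
    proof (cases "set xs \<inter> I = {}")
      case True
      then have "filter (\<lambda>x. x \<in> I) xs = []"
        by (auto simp: filter_empty_conv)
      moreover have "0 < length (filter (\<lambda>x. x \<in> K) xs)" if "x \<in> I"
        using assms(4)[OF xy that] Cons by auto
      ultimately show ?thesis
        using True by (auto simp: Suc_le_eq)
    next
      \<comment> \<open>If \<open>x\<close> is in \<open>I\<close>, then \<open>y\<close> is in
        \<open>K\<close>, so not in \<open>I\<close>, and the extra 1 of the induction hypothesis
        pays for \<open>x\<close>. If \<open>y\<close> is in \<open>I\<close>, then \<open>x\<close>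
        is in \<open>K\<close> and provides the extra 1.\<close>
      case False
      then show ?thesis
        using IH xy assms(4-6) by (auto split: if_splits)
    qed
  qed
qed simp

text \<open>
  Around a hamiltonian cycle, every vertex of \<open>I\<close> is preceded and followed by one of \<open>K\<close>. Started at
  a vertex outside \<open>I \<union> K\<close>, the cycle visits \<open>K\<close> once more often than \<open>I\<close>.
\<close>

lemma not_ham_cycle_if_separated:
  assumes "\<And>x y. (x, y) \<in> E \<Longrightarrow> x \<in> I \<Longrightarrow> y \<in> K" "\<And>x y. (x, y) \<in> E \<Longrightarrow> y \<in> I \<Longrightarrow> x \<in> K"
    and "I \<inter> K = {}" "I \<subseteq> V" "I \<noteq> {}" "K \<subseteq> V" "card K \<le> card I" "r \<in> V - I - K"
  shows "\<not> ham_cycle V E xs"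
proof
  assume xs: "ham_cycle V E xs"
  then have "r \<in> set xs"
    using assms(8) by (simp add: ham_cycle_def)
  then obtain as bs where "xs = as @ r # bs"
    by (metis split_list)
  then have "ham_cycle V E ((r # bs) @ as)"
    using xs by (intro ham_cycle_rotate[of _ _ as]) simp
  then obtain ys where ys: "ham_cycle V E ys" "hd ys = r"
    by (metis append_Cons list.sel(1))
  then have suc: "successively (\<lambda>x y. (x, y) \<in> E) ys" "ys \<noteq> []" "(last ys, r) \<in> E"
    and V: "distinct ys" "set ys = V"
    unfolding ham_cycle_def by auto
  have meets: "set ys \<inter> I \<noteq> {}" and r: "hd ys \<notin> I"
    using assms(4,5,8) ys(2) V(2) by auto
  \<comment> \<open>Cyclically, the last vertex is followed by \<open>r\<close>, which is not in
    \<open>K\<close>.\<close>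
  have "last ys \<notin> I"
    using assms(1)[OF suc(3)] assms(8) by auto
  then have "length (filter (\<lambda>x. x \<in> I) ys) + 1 \<le> length (filter (\<lambda>x. x \<in> K) ys)"
    using successively_count_le[OF suc(2,1) \<open>last ys \<notin> I\<close> assms(1-3)] meets r by simp
  moreover have "length (filter (\<lambda>x. x \<in> A) ys) = card A" if "A \<subseteq> V" for A
  proof -
    have "length (filter (\<lambda>x. x \<in> A) ys) = card (set (filter (\<lambda>x. x \<in> A) ys))"
      using V(1) by (metis distinct_card distinct_filter)
    also have "set (filter (\<lambda>x. x \<in> A) ys) = A"
      using V(2) that by auto
    finally show ?thesis .
  qed
  ultimately show False
    using assms(4,6,7) by simp
qed

lemma pair_graph_extremal:
  assumes "2 * k \<le> n"
  shows "pair_graph (extremal_graph n k)"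
proof unfold_locales
  have "parcs (extremal_graph n k) \<subseteq> {..<n} \<times> {..<n}"
    using assms by (auto simp: extremal_graph_def)
  then show "finite (parcs (extremal_graph n k))"
    by (meson finite_SigmaI finite_lessThan finite_subset)
  show "symmetric (with_proj (extremal_graph n k))"
    by (auto simp: symmetric_def sym_def extremal_graph_def)
qed (use assms in \<open>auto simp: extremal_graph_def\<close>)

lemma not_hamiltonian_extremal:
  assumes "1 \<le> k" "2 * k < n"
  shows "\<not> hamiltonian (extremal_graph n k)"
  unfolding hamiltonian_iff_ham_cycle not_ex
proof
  fix xs
  show "\<not> ham_cycle (pverts (extremal_graph n k)) (parcs (extremal_graph n k)) xs"
    \<comment> \<open>From \<open>2 * k < n\<close>, the vertex \<open>k\<close> lies in the clique
      but outside the common neighbourhood.\<close>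
    using assms by (intro not_ham_cycle_if_separated[where I = "{n - k..<n}" and K = "{..<k}" and r = k])
      (auto simp: extremal_graph_def)
qed

lemma card_parcs_extremal:
  assumes "2 * k \<le> n"
  shows "card (parcs (extremal_graph n k)) = (n - k) * (n - k - 1) + 2 * k\<^sup>2"
proof -
  let ?A = "Sigma {..<n - k} (\<lambda>u. {..<n - k} - {u})" and ?B = "{..<k} \<times> {n - k..<n}"
    and ?C = "{n - k..<n} \<times> {..<k}"
  have "parcs (extremal_graph n k) = ?A \<union> ?B \<union> ?C"
    by (auto simp: extremal_graph_def)
  moreover have "card (?A \<union> ?B \<union> ?C) = card ?A + card ?B + card ?C"
    using assms by (subst card_Un_disjoint; auto)+
  moreover have "card ?A = (n - k) * (n - k - 1)"
    by (simp add: card_SigmaI)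
  moreover have "card ?B = k\<^sup>2" "card ?C = k\<^sup>2"
    using assms by (simp_all add: card_cartesian_product power2_eq_square)
  ultimately show ?thesis
    by simp
qed

lemma card_edges_extremal:
  assumes "2 * k \<le> n"
  shows "card (edges (extremal_graph n k)) = ((n - k) choose 2) + k\<^sup>2"
  using card_parcs_extremal[OF assms] card_parcs_eq_twice_edges[OF pair_graph_extremal[OF assms]]
    twice_choose_two[of "n - k"]
  by linarith

text \<open>Deleting fewer than \<open>k\<close> vertices spares some \<open>c\<close> in
  \<open>{..<k}\<close>. This vertex is adjacent to all others, so any two remaining vertices are
  linked through it.\<close>

lemma k_connected_extremal:
  assumes "2 * k \<le> n" "k < n"
  shows "k_connected k (extremal_graph n k)"
  unfolding k_connected_def
proof (intro conjI allI impI)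
  let ?G = "extremal_graph n k"
  show "k < card (pverts ?G)"
    using assms by (simp add: extremal_graph_def)
  fix S assume S: "S \<subseteq> pverts ?G" "card S < k"
  interpret G: pair_graph ?G
    using assms(1) by (rule pair_graph_extremal)
  let ?H = "with_proj ?G \<restriction> (pverts ?G - S)"
  let ?M = "mk_symmetric ?H"
  interpret M: pair_wf_digraph ?M
    by unfold_locales (auto simp: parcs_mk_symmetric G.wellformed')
  have "finite S"
    using S(1) by (rule finite_subset) (simp add: extremal_graph_def)
  then have "\<not> {..<k} \<subseteq> S"
    using S(2) by (metis card_lessThan card_mono not_less)
  then obtain c where c: "c < k" "c \<notin> S"
    by auto
  then have cV: "c \<in> pverts ?M"
    using assms by (simp add: extremal_graph_def)
  have arcs: "parcs ?G \<inter> (UNIV - S) \<times> (UNIV - S) \<subseteq> parcs ?M"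
    using G.wellformed' by (force simp: parcs_mk_symmetric)
  have adj: "(c, u) \<in> parcs ?M \<and> (u, c) \<in> parcs ?M" if "u \<in> pverts ?M" "u \<noteq> c" for u
  proof -
    have "(c, u) \<in> parcs ?G" "(u, c) \<in> parcs ?G" "u \<notin> S"
      using that c assms by (auto simp: extremal_graph_def)
    then show ?thesis
      using arcs c by auto
  qed
  have "c \<rightarrow>\<^sup>*\<^bsub>with_proj ?M\<^esub> u \<and> u \<rightarrow>\<^sup>*\<^bsub>with_proj ?M\<^esub> c" if "u \<in> pverts ?M" for u
    using that adj[OF that] M.reachable_adjI M.reachable_refl by (cases "u = c") auto
  then have "strongly_connected (with_proj ?M)"
    unfolding strongly_connected_def using cV M.reachable_trans by (metis empty_iff with_proj_simps(1))
  then show "Digraph_Component.connected ?H"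
    by (simp add: connected_def)
qed

section \<open>Isomorphism with the extremal graph\<close>

lemma digraph_iso_of_bij:
  assumes "pair_wf_digraph G" and f: "bij_betw f (pverts G) (pverts H)"
    and "pair_wf_digraph H"
    and arcs: "\<And>u v. u \<in> pverts G \<Longrightarrow> v \<in> pverts G \<Longrightarrow> (u, v) \<in> parcs G \<longleftrightarrow> (f u, f v) \<in> parcs H"
  shows "digraph_iso (with_proj G) (with_proj H)"
proof -
  interpret G: pair_wf_digraph G by fact
  interpret H: pair_wf_digraph H by fact
  \<comment> \<open>Arcs are pairs of vertices, so the vertex map determines the arc map, and heads
    and tails stay projections.\<close>
  let ?h = "\<lparr>iso_verts = f, iso_arcs = map_prod f f, iso_head = snd, iso_tail = fst\<rparr>"
  have inj: "inj_on f (pverts G)" and img: "f ` pverts G = pverts H"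
    using f by (auto simp: bij_betw_def)
  have "inj_on (map_prod f f) (parcs G)"
    using map_prod_inj_on[OF inj inj] by (rule inj_on_subset) (auto dest: G.wellformed')
  then have "pre_digraph.digraph_isomorphism (with_proj G) ?h"
    using inj G.wf_digraph_axioms by (auto simp: pre_digraph.digraph_isomorphism_def)
  moreover have "map_prod f f ` parcs G = parcs H"
  proof (intro equalityI subsetI)
    fix a assume "a \<in> map_prod f f ` parcs G"
    then show "a \<in> parcs H"
      using arcs by (auto dest: G.wellformed')
  next
    fix a assume a: "a \<in> parcs H"
    then have "fst a \<in> f ` pverts G" "snd a \<in> f ` pverts G"
      using img H.arc_fst_in_verts H.arc_snd_in_verts by auto
    then obtain u v where uv: "u \<in> pverts G" "v \<in> pverts G" "a = (f u, f v)"
      by (metis imageE prod.collapse)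
    then have "(u, v) \<in> parcs G"
      using a arcs by simp
    then show "a \<in> map_prod f f ` parcs G"
      using uv(3) by force
  qed
  then have "with_proj H = app_iso ?h (with_proj G)"
    using img by (simp add: app_iso_def with_proj_def)
  ultimately show ?thesis
    unfolding digraph_iso_def by blast
qed

text \<open>Three bijections are glued: \<open>K\<close> goes to \<open>{..<k}\<close>, the rest of
  the clique to \<open>{k..<n - k}\<close>, and \<open>S\<close> to \<open>{n - k..<n}\<close>.
  Adjacency depends only on these blocks and on equality of vertices.\<close>

lemma extremal_structure_iso:
  assumes G: "pair_graph G" and n: "card (pverts G) = n" "2 * k \<le> n"
    and S: "S \<subseteq> pverts G" "card S = k" and K: "K \<subseteq> pverts G - S" "card K = k"
    and E: "parcs G = {(x, y). x \<in> pverts G - S \<and> y \<in> pverts G - S \<and> x \<noteq> y} \<union> K \<times> S \<union> S \<times> K"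
  shows "digraph_iso (with_proj G) (with_proj (extremal_graph n k))"
proof -
  interpret G: pair_graph G by (rule G)
  interpret H: pair_graph "extremal_graph n k"
    using n(2) by (rule pair_graph_extremal)
  let ?V = "pverts G" and ?L = "pverts G - S - K"
  have fin: "finite S" "finite K" "finite ?L"
    using S(1) K(1) G.pair_finite_verts by (auto intro: finite_subset)
  have "card ?L = n - k - k"
    using S K n fin by (simp add: card_Diff_subset)
  obtain f where f: "bij_betw f K {..<k}"
    using finite_same_card_bij[of K "{..<k}"] fin K(2) by auto
  obtain g where g: "bij_betw g ?L {k..<n - k}"
    using finite_same_card_bij[of ?L "{k..<n - k}"] fin \<open>card ?L = n - k - k\<close> by auto
  obtain h where h: "bij_betw h S {n - k..<n}"
    using finite_same_card_bij[of S "{n - k..<n}"] fin S(2) n(2) by auto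
  define F where "F x = (if x \<in> S then h x else if x \<in> K then f x else g x)" for x
  have FK: "bij_betw F K {..<k}"
    using f K(1) by (subst bij_betw_cong[of _ _ f]) (auto simp: F_def)
  have FL: "bij_betw F ?L {k..<n - k}"
    using g by (subst bij_betw_cong[of _ _ g]) (auto simp: F_def)
  have FS: "bij_betw F S {n - k..<n}"
    using h by (subst bij_betw_cong[of _ _ h]) (auto simp: F_def)
  have "bij_betw F (K \<union> ?L) ({..<k} \<union> {k..<n - k})"
    by (rule bij_betw_combine[OF FK FL]) auto
  moreover have "K \<union> ?L = ?V - S" "{..<k} \<union> {k..<n - k} = {..<n - k}"
    using K(1) n(2) by auto
  ultimately have FR: "bij_betw F (?V - S) {..<n - k}"
    by simp
  have "bij_betw F ((?V - S) \<union> S) ({..<n - k} \<union> {n - k..<n})"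
    by (rule bij_betw_combine[OF FR FS]) auto
  moreover have "?V - S \<union> S = ?V" "{..<n - k} \<union> {n - k..<n} = {..<n}"
    using S(1) by auto
  ultimately have F: "bij_betw F ?V {..<n}"
    by simp
  have inj: "F x = F y \<longleftrightarrow> x = y" if "x \<in> ?V" "y \<in> ?V" for x y
    using F that by (auto simp: bij_betw_def inj_on_eq_iff)
  \<comment> \<open>Block membership is turned into inequalities on \<open>F x\<close>, the form in
    which \<open>extremal_graph\<close> describes its arcs.\<close>
  have S_iff: "x \<in> S \<longleftrightarrow> n - k \<le> F x" if "x \<in> ?V" for x
  proof (cases "x \<in> S")
    case True
    then show ?thesis
      using bij_betwE[OF FS] by auto
  next
    case False
    then show ?thesis
      using bij_betwE[OF FR] that by force
  qed
  have K_iff: "x \<in> K \<longleftrightarrow> F x < k" if x: "x \<in> ?V" for x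
  proof -
    consider "x \<in> K" | "x \<in> ?L" | "x \<in> S"
      using x by blast
    then show ?thesis
    proof cases
      case 1
      then show ?thesis
        using bij_betwE[OF FK] by auto
    next
      case 2
      then show ?thesis
        using bij_betwE[OF FL] by force
    next
      case 3
      then show ?thesis
        using bij_betwE[OF FS] K(1) n(2) by force
    qed
  qed
  have lt: "F x < n" if "x \<in> ?V" for x
    using bij_betwE[OF F] that by auto
  show ?thesis
  proof (rule digraph_iso_of_bij)
    show "bij_betw F ?V (pverts (extremal_graph n k))"
      using F by (simp add: extremal_graph_def)
    show "(x, y) \<in> parcs G \<longleftrightarrow> (F x, F y) \<in> parcs (extremal_graph n k)"
      if "x \<in> ?V" "y \<in> ?V" for x y
      using that lt inj[OF that] unfolding E
      by (simp add: extremal_graph_def S_iff K_iff not_le)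
  qed unfold_locales
qed

section \<open>The edge bound and the equality case for \<open>k\<close>-connected graphs\<close>

text \<open>Connectivity enters as the minimum degree \<open>k\<close>; the arc counts of
  \<open>nonham_bound\<close> are then halved.\<close>

lemma nonhamiltonian_bound:
  assumes "1 \<le> k" "2 * (k\<^sup>2 + k) \<le> n"
    and G: "pair_graph G" "card (pverts G) = n" "k_connected k G" "\<not> hamiltonian G"
  shows "card (edges G) \<le> ((n - k) choose 2) + k\<^sup>2"
    and "card (edges G) = ((n - k) choose 2) + k\<^sup>2 \<Longrightarrow> (k, n) \<noteq> (1, 5) \<Longrightarrow>
      digraph_iso (with_proj G) (with_proj (extremal_graph n k))"
proof -
  interpret simple_graph "pverts G" "parcs G"
    using G(1) by (rule pair_graph_simple_graph)
  have nonham: "\<nexists>xs. ham_cycle (pverts G) (parcs G) xs"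
    using G(4) by (simp add: hamiltonian_iff_ham_cycle)
  have k: "2 * (k\<^sup>2 + k) \<le> card (pverts G)"
    using assms(2) G(2) by simp
  note bound = nonham_bound[OF nonham assms(1) k k_connected_min_degree[OF G(1,3)], unfolded G(2)]
  note count = card_parcs_eq_twice_edges[OF G(1)] twice_choose_two[of "n - k"]
  show "card (edges G) \<le> ((n - k) choose 2) + k\<^sup>2"
    using bound(1) count by linarith
  assume eq: "card (edges G) = ((n - k) choose 2) + k\<^sup>2" and ne: "(k, n) \<noteq> (1, 5)"
  have "card (parcs G) = (n - k) * (n - k - 1) + 2 * k\<^sup>2"
    using eq count by linarith
  then obtain S K where "S \<subseteq> pverts G" "K \<subseteq> pverts G - S" "card S = k" "card K = k"
    "parcs G = {(x, y). x \<in> pverts G - S \<and> y \<in> pverts G - S \<and> x \<noteq> y} \<union> K \<times> S \<union> S \<times> K"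
    using bound(2) ne by blast
  moreover have "2 * k \<le> n"
    using assms(2) by (simp add: algebra_simps)
  ultimately show "digraph_iso (with_proj G) (with_proj (extremal_graph n k))"
    using extremal_structure_iso[OF G(1,2)] by blast
qed

text \<open>Existence is witnessed by a concrete graph on \<open>nat\<close>, while the bound and
  uniqueness concern an arbitrary vertex type; uniqueness therefore means isomorphism with that
  graph. The pair \<open>(1, 5)\<close> is exempted because \<open>extremal_graph 5 2\<close>
  attains the bound there too.\<close>

theorem theorem3:
  fixes k n :: nat
  assumes "k \<ge> 1" and "n \<ge> 2 * (k\<^sup>2 + k)"
  shows
    "(\<forall>G :: 'a pair_pre_digraph.
        pair_graph G \<and> card (pverts G) = n \<and> k_connected k G \<and>
        card (edges G) > ((n - k) choose 2) + k\<^sup>2 \<longrightarrow> hamiltonian G)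
     \<and>
     (pair_graph (extremal_graph n k) \<and> card (pverts (extremal_graph n k)) = n \<and>
      k_connected k (extremal_graph n k) \<and> \<not> hamiltonian (extremal_graph n k) \<and>
      card (edges (extremal_graph n k)) = ((n - k) choose 2) + k\<^sup>2)
     \<and>
     ((k, n) \<noteq> (1, 5) \<longrightarrow>
      (\<forall>G :: 'a pair_pre_digraph.
        pair_graph G \<and> card (pverts G) = n \<and> k_connected k G \<and> \<not> hamiltonian G \<and>
        card (edges G) = ((n - k) choose 2) + k\<^sup>2 \<longrightarrow>
        digraph_iso (with_proj G) (with_proj (extremal_graph n k))))"
proof (intro conjI allI impI; (elim conjE)?)
  have "0 < k\<^sup>2"
    using assms(1) by simp
  moreover have "2 * k\<^sup>2 + 2 * k \<le> n"
    using assms(2) by (simp add: algebra_simps)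
  ultimately have n: "2 * k < n" "2 * k \<le> n" "k < n"
    by linarith+
  show "pair_graph (extremal_graph n k)"
    using n(2) by (rule pair_graph_extremal)
  show "card (pverts (extremal_graph n k)) = n"
    by (simp add: extremal_graph_def)
  show "k_connected k (extremal_graph n k)"
    using n(2,3) by (rule k_connected_extremal)
  show "\<not> hamiltonian (extremal_graph n k)"
    using assms(1) n(1) by (rule not_hamiltonian_extremal)
  show "card (edges (extremal_graph n k)) = ((n - k) choose 2) + k\<^sup>2"
    using n(2) by (rule card_edges_extremal)
next
  fix G :: "'a pair_pre_digraph"
  assume "pair_graph G" "card (pverts G) = n" "k_connected k G"
    "((n - k) choose 2) + k\<^sup>2 < card (edges G)"
  then show "hamiltonian G"
    using nonhamiltonian_bound(1)[OF assms, of G] not_less by blast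
next
  fix G :: "'a pair_pre_digraph"
  assume "(k, n) \<noteq> (1, 5)" "pair_graph G" "card (pverts G) = n" "k_connected k G"
    "\<not> hamiltonian G" "card (edges G) = ((n - k) choose 2) + k\<^sup>2"
  then show "digraph_iso (with_proj G) (with_proj (extremal_graph n k))"
    using nonhamiltonian_bound(2)[OF assms] by blast
qed

end
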